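(* Let $\mathcal{H}_1,\mathcal{H}_2$ be separable complex Hilbert spaces with $\dim\mathcal{H}_1>1$ and $\dim\mathcal{H}_2>1$, let $\mathcal{H}=\mathcal{H}_1\otimes\mathcal{H}_2$, and let $(X,\mu)=(X_1\times X_2,\mu_1\otimes\mu_2)$ be a product of measure spaces with $\sigma$-finite positive measures. Let $F_1:X_1\to\mathcal{H}_1$, $F_2:X_2\to\mathcal{H}_2$ be such that $F_1\otimes F_2$ is a redundant continuous frame for $\mathcal{H}$ with respect to $(X,\mu)$. Then $F_1\otimes F_2$ admits at least one non-simple dual frame, i.e. there is a continuous dual frame $G:X\to\mathcal{H}$ of $F_1\otimes F_2$ that is not of the form $G=G_1\otimes G_2$ for any mappings $G_1:X_1\to\mathcal{H}_1$, $G_2:X_2\to\mathcal{H}_2$.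
   Context: $\mathcal{H}_1\otimes\mathcal{H}_2$ is the Hilbert space tensor product; $(F_1\otimes F_2)(x_1,x_2)=F_1(x_1)\otimes F_2(x_2)$. A weakly measurable mapping $F:X\to\mathcal{H}$ is a continuous frame for $\mathcal{H}$ with respect to $(X,\mu)$ if there are $A>0$, $B<\infty$ with $A\|f\|^2\le\int_X|\langle f,F(x)\rangle|^2d\mu(x)\le B\|f\|^2$ for all $f\in\mathcal{H}$. Its analysis operator is $T_F^*:\mathcal{H}\to L^2(X,\mu)$, $(T_F^*f)(x)=\langle f,F(x)\rangle$. The frame $F$ is redundant if $\dim\big((\operatorname{ran}T_F^* )^\perp\big)>0$, the orthogonal complement being taken in $L^2(X,\mu)$. A continuous frame $G$ is a continuous dual frame of $F$ if $\langle f,g\rangle=\int_X\langle f,F(x)\rangle\langle G(x),g\rangle\,d\mu(x)$ for all $f,g\in\mathcal{H}$. *)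

theory Defs
  imports "HOL-Analysis.Analysis" "HOL-Library.Extended_Nat"
begin

section \<open>Complex Hilbert spaces\<close>

class complex_vector = real_vector +
  fixes scaleC :: "complex \<Rightarrow> 'a \<Rightarrow> 'a" (infixr "*\<^sub>C" 75)
  assumes scaleC_add_right: "a *\<^sub>C (x + y) = a *\<^sub>C x + a *\<^sub>C y"
    and scaleC_add_left: "(a + b) *\<^sub>C x = a *\<^sub>C x + b *\<^sub>C x"
    and scaleC_scaleC: "a *\<^sub>C b *\<^sub>C x = (a * b) *\<^sub>C x"
    and scaleC_one: "1 *\<^sub>C x = x"
    and scaleR_scaleC: "r *\<^sub>R x = complex_of_real r *\<^sub>C x"

global_interpretation complex_vector:
  vector_space "scaleC :: complex \<Rightarrow> 'a \<Rightarrow> 'a::complex_vector"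
  by unfold_locales (rule scaleC_add_right scaleC_add_left scaleC_scaleC scaleC_one)+

text \<open>The inner product is linear in the first and conjugate-linear in the second argument,
  so that \<open>f \<mapsto> \<langle>f, F x\<rangle>\<close> is linear.\<close>

class complex_inner = complex_vector + real_normed_vector +
  fixes cinner :: "'a \<Rightarrow> 'a \<Rightarrow> complex"
  assumes cinner_commute: "cinner x y = cnj (cinner y x)"
    and cinner_add_left: "cinner (x + y) z = cinner x z + cinner y z"
    and cinner_scaleC_left: "cinner (a *\<^sub>C x) y = a * cinner x y"
    and cinner_self: "cinner x x = complex_of_real ((norm x)\<^sup>2)"

class chilbert_space = complex_inner + complete_space

text \<open>The library's \<^term>\<open>vector_space.dim\<close> is \<open>0\<close> on infinite-dimensional spaces; here all
  infinite dimensions are identified with \<^term>\<open>\<infinity>::enat\<close>.\<close>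

definition cdim :: "'a::complex_vector set \<Rightarrow> enat" where
  "cdim V = (SUP B \<in> {B. B \<subseteq> V \<and> finite B \<and> complex_vector.independent B}. enat (card B))"

text \<open>A Hilbert space tensor product is only determined up to unitary isomorphism.
  The predicate says that the target space, together with the map \<open>t = (\<otimes>)\<close>, is a completion of
  the algebraic tensor product with respect to the inner product given on simple tensors by
  \<open>\<langle>a \<otimes> b, c \<otimes> d\<rangle> = \<langle>a, c\<rangle> \<langle>b, d\<rangle>\<close>.\<close>

definition hilbert_tensor_product ::
    "('a::chilbert_space \<Rightarrow> 'b::chilbert_space \<Rightarrow> 'h::chilbert_space) \<Rightarrow> bool" where
  "hilbert_tensor_product t \<longleftrightarrow>
     (\<forall>a a' b. t (a + a') b = t a b + t a' b) \<and>
     (\<forall>a b b'. t a (b + b') = t a b + t a b') \<and>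
     (\<forall>c a b. t (c *\<^sub>C a) b = c *\<^sub>C t a b) \<and>
     (\<forall>c a b. t a (c *\<^sub>C b) = c *\<^sub>C t a b) \<and>
     (\<forall>a b c d. cinner (t a b) (t c d) = cinner a c * cinner b d) \<and>
     closure (complex_vector.span {t a b | a b. True}) = UNIV"

definition tensor_map ::
    "('a \<Rightarrow> 'b \<Rightarrow> 'h) \<Rightarrow> ('x \<Rightarrow> 'a) \<Rightarrow> ('y \<Rightarrow> 'b) \<Rightarrow> 'x \<times> 'y \<Rightarrow> 'h" where
  "tensor_map t F1 F2 = (\<lambda>(x1, x2). t (F1 x1) (F2 x2))"

section \<open>The space $L^2$\<close>

text \<open>Elements of \<open>L\<^sup>2\<close> are represented by functions; identification of functions that agree
  almost everywhere is built into linear independence, hence into the dimension.\<close>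

definition L2_space :: "'x measure \<Rightarrow> ('x \<Rightarrow> complex) set" where
  "L2_space M = {h \<in> borel_measurable M. integrable M (\<lambda>x. (cmod (h x))\<^sup>2)}"

definition L2_inner :: "'x measure \<Rightarrow> ('x \<Rightarrow> complex) \<Rightarrow> ('x \<Rightarrow> complex) \<Rightarrow> complex" where
  "L2_inner M g h = (LINT x|M. g x * cnj (h x))"

definition L2_orthogonal_complement ::
    "'x measure \<Rightarrow> ('x \<Rightarrow> complex) set \<Rightarrow> ('x \<Rightarrow> complex) set" where
  "L2_orthogonal_complement M V = {h \<in> L2_space M. \<forall>g\<in>V. L2_inner M g h = 0}"

definition L2_independent :: "'x measure \<Rightarrow> ('x \<Rightarrow> complex) set \<Rightarrow> bool" where
  "L2_independent M B \<longleftrightarrow>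
     (\<forall>c :: ('x \<Rightarrow> complex) \<Rightarrow> complex.
        (AE x in M. (\<Sum>b\<in>B. c b * b x) = 0) \<longrightarrow> (\<forall>b\<in>B. c b = 0))"

definition L2_dim :: "'x measure \<Rightarrow> ('x \<Rightarrow> complex) set \<Rightarrow> enat" where
  "L2_dim M V = (SUP B \<in> {B. B \<subseteq> V \<and> finite B \<and> L2_independent M B}. enat (card B))"

section \<open>Continuous frames\<close>

definition weakly_measurable :: "'x measure \<Rightarrow> ('x \<Rightarrow> 'h::complex_inner) \<Rightarrow> bool" where
  "weakly_measurable M F \<longleftrightarrow> (\<forall>f. (\<lambda>x. cinner f (F x)) \<in> borel_measurable M)"

definition continuous_frame :: "'x measure \<Rightarrow> ('x \<Rightarrow> 'h::chilbert_space) \<Rightarrow> bool" where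
  "continuous_frame M F \<longleftrightarrow> weakly_measurable M F \<and>
     (\<exists>A B :: real. A > 0 \<and>
        (\<forall>f. ennreal (A * (norm f)\<^sup>2) \<le> (\<integral>\<^sup>+ x. ennreal ((cmod (cinner f (F x)))\<^sup>2) \<partial>M) \<and>
             (\<integral>\<^sup>+ x. ennreal ((cmod (cinner f (F x)))\<^sup>2) \<partial>M) \<le> ennreal (B * (norm f)\<^sup>2)))"

definition analysis_operator :: "('x \<Rightarrow> 'h::chilbert_space) \<Rightarrow> 'h \<Rightarrow> 'x \<Rightarrow> complex" where
  "analysis_operator F f = (\<lambda>x. cinner f (F x))"

definition redundant_frame :: "'x measure \<Rightarrow> ('x \<Rightarrow> 'h::chilbert_space) \<Rightarrow> bool" where
  "redundant_frame M F \<longleftrightarrow> continuous_frame M F \<and>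
     L2_dim M (L2_orthogonal_complement M (range (analysis_operator F))) > 0"

definition continuous_dual_frame ::
    "'x measure \<Rightarrow> ('x \<Rightarrow> 'h::chilbert_space) \<Rightarrow> ('x \<Rightarrow> 'h) \<Rightarrow> bool" where
  "continuous_dual_frame M F G \<longleftrightarrow> continuous_frame M F \<and> continuous_frame M G \<and>
     (\<forall>f g. cinner f g = (LINT x|M. cinner f (F x) * cinner (G x) g))"

end

theory Submission
  imports Defs
begin

text \<open>
  A dual frame of a redundant frame \<open>F\<close> can be given any prescribed value at a suitable point.
  Redundancy supplies a function \<open>h \<noteq> 0\<close> in \<open>L\<^sup>2\<close> orthogonal to the range of the analysis
  operator, hence a point \<open>x\<^sub>0\<close> with \<open>h x\<^sub>0 \<noteq> 0\<close>. If \<open>G\<close> is a dual frame of \<open>F\<close>, then so is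
  \<open>x \<mapsto> G x + cnj (h x) \<phi>\<close> for every vector \<open>\<phi>\<close> (\<open>perturbed_dual_frame\<close>), and as \<open>\<phi>\<close> varies,
  its value at \<open>x\<^sub>0\<close> runs through the whole Hilbert space
  (\<open>redundant_frame_dual_with_prescribed_value\<close>). When both tensor factors have dimension at
  least two, some vector of the product is not a simple tensor (\<open>exists_non_simple_tensor\<close>). A dual
  frame of \<open>F\<^sub>1 \<otimes> F\<^sub>2\<close> taking this value at \<open>x\<^sub>0\<close> is not of the form \<open>G\<^sub>1 \<otimes> G\<^sub>2\<close>.

  The perturbation needs a dual frame to start from, namely \<open>S\<inverse> F\<close>, where \<open>S\<close> is the frame
  operator (\<open>canonical_dual_frame\<close>). The operator \<open>S\<close> itself is never formed: the frame
  inequalities say that \<open>(u, v) \<mapsto> \<integral> \<langle>u, F x\<rangle> \<langle>F x, v\<rangle>\<close> is a bounded coercive hermitian form, and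
  \<open>S\<inverse> f\<close> is the vector that represents \<open>v \<mapsto> \<langle>f, v\<rangle>\<close> by this form, obtained by minimising a
  quadratic functional (\<open>coercive_form_represents_functional\<close>).
\<close>

section \<open>Complex inner product spaces\<close>

lemma cinner_add_right: "cinner x (y + z) = cinner x y + cinner x (z::'a::complex_inner)"
  by (metis cinner_add_left cinner_commute complex_cnj_add)

lemma cinner_scaleC_right: "cinner x (a *\<^sub>C y) = cnj a * cinner x (y::'a::complex_inner)"
  by (metis cinner_scaleC_left cinner_commute complex_cnj_mult)

lemma scaleC_minus_one: "(-1) *\<^sub>C x = - (x::'a::complex_vector)"
  using complex_vector.scale_minus_left[of 1 x] by (simp add: scaleC_one)

lemma cinner_minus_left: "cinner (- x) y = - cinner x (y::'a::complex_inner)"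
  using cinner_scaleC_left[of "-1" x y] by (simp add: scaleC_minus_one)

lemma cinner_diff_left: "cinner (x - z) y = cinner x y - cinner z (y::'a::complex_inner)"
  using cinner_add_left[of x "- z" y] by (simp add: cinner_minus_left)

lemma norm_scaleC: "norm (a *\<^sub>C x) = cmod a * norm (x::'a::complex_inner)"
proof -
  have "complex_of_real ((norm (a *\<^sub>C x))\<^sup>2) = a * cnj a * complex_of_real ((norm x)\<^sup>2)"
    by (metis cinner_self cinner_scaleC_left cinner_scaleC_right mult.assoc)
  also have "\<dots> = complex_of_real ((cmod a * norm x)\<^sup>2)"
    by (simp add: complex_norm_square[symmetric] power_mult_distrib)
  finally have "(norm (a *\<^sub>C x))\<^sup>2 = (cmod a * norm x)\<^sup>2"
    using of_real_eq_iff by blast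
  then show ?thesis
    by simp
qed

lemma Re_cinner_le: "Re (cinner x y) \<le> norm x * norm (y::'a::complex_inner)"
proof -
  have "complex_of_real ((norm (x + y))\<^sup>2) =
      complex_of_real ((norm x)\<^sup>2) + cinner x y + cnj (cinner x y) + complex_of_real ((norm y)\<^sup>2)"
    unfolding cinner_self[symmetric]
    by (metis cinner_add_left cinner_add_right cinner_commute add.assoc)
  then have "Re (complex_of_real ((norm (x + y))\<^sup>2)) =
      Re (complex_of_real ((norm x)\<^sup>2) + cinner x y + cnj (cinner x y)
        + complex_of_real ((norm y)\<^sup>2))"
    by (rule arg_cong)
  then have "(norm (x + y))\<^sup>2 = (norm x)\<^sup>2 + 2 * Re (cinner x y) + (norm y)\<^sup>2"
    by simp
  moreover have "(norm (x + y))\<^sup>2 \<le> (norm x + norm y)\<^sup>2"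
    by (intro power_mono norm_triangle_ineq) simp
  ultimately show ?thesis
    by (simp add: power2_sum)
qed

text \<open>The triangle inequality of the norm bounds the real part; multiplying \<open>x\<close> by a unit
  scalar makes the inner product real and nonnegative.\<close>

lemma cinner_Cauchy_Schwarz: "cmod (cinner x y) \<le> norm x * norm (y::'a::complex_inner)"
proof (cases "cinner x y = 0")
  case False
  let ?u = "cnj (sgn (cinner x y))"
  have "complex_of_real (cmod (cinner x y)) = cinner (?u *\<^sub>C x) y"
    using False
    by (simp add: cinner_scaleC_left sgn_eq complex_norm_square[symmetric] power2_eq_square
        field_simps)
  then have "cmod (cinner x y) = Re (cinner (?u *\<^sub>C x) y)"
    by (metis Re_complex_of_real)
  also have "\<dots> \<le> norm (?u *\<^sub>C x) * norm y"
    by (rule Re_cinner_le)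
  also have "norm (?u *\<^sub>C x) = norm x"
    using False by (simp add: norm_scaleC norm_sgn)
  finally show ?thesis .
qed simp

text \<open>One Gram--Schmidt step applied to two independent vectors; independence keeps the corrected
  vector nonzero.\<close>

lemma orthogonal_pair_if_cdim_gt_one:
  assumes "cdim (UNIV :: 'a::complex_inner set) > 1"
  obtains u v :: "'a::complex_inner" where "u \<noteq> 0" "v \<noteq> 0" "cinner u v = 0" "cinner v u = 0"
proof -
  from assms obtain B :: "'a set" where B: "finite B" "complex_vector.independent B" "card B > 1"
    unfolding cdim_def less_SUP_iff by (auto simp: one_enat_def)
  then obtain u v where uv: "u \<in> B" "v \<in> B" "u \<noteq> v"
    by (metis One_nat_def card_le_Suc0_iff_eq not_le)
  have u0: "u \<noteq> 0"
    using B(2) uv(1) complex_vector.dependent_zero by blast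
  define w where "w = v - (cinner v u / cinner u u) *\<^sub>C u"
  have uu: "cinner u u \<noteq> 0"
    using u0 by (simp add: cinner_self)
  have "w \<noteq> 0"
  proof
    assume "w = 0"
    then have "v \<in> complex_vector.span {u}"
      unfolding w_def by (simp add: complex_vector.span_singleton)
    moreover have "complex_vector.span {u} \<subseteq> complex_vector.span (B - {v})"
      using uv by (intro complex_vector.span_mono) auto
    ultimately show False
      using B(2) uv(2) unfolding complex_vector.dependent_def by blast
  qed
  moreover have wu: "cinner w u = 0"
    using uu by (simp add: w_def cinner_diff_left cinner_scaleC_left)
  moreover have "cinner u w = 0"
    using wu cinner_commute[of u w] by simp
  ultimately show thesis
    using that u0 by blast
qed

section \<open>Non-simple tensors\<close>

text \<open>For orthogonal pairs \<open>a\<^sub>1, a\<^sub>2\<close> and \<open>b\<^sub>1, b\<^sub>2\<close>, the vector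
  \<open>a\<^sub>1 \<otimes> b\<^sub>1 + a\<^sub>2 \<otimes> b\<^sub>2\<close> has rank two: its coefficient matrix against \<open>a\<^sub>i \<otimes> b\<^sub>j\<close> is diagonal
  with nonzero diagonal, whereas the matrix \<open>\<langle>a, a\<^sub>i\<rangle> \<langle>b, b\<^sub>j\<rangle>\<close> of a simple tensor
  has determinant zero.\<close>

lemma exists_non_simple_tensor:
  fixes t :: "'a::chilbert_space \<Rightarrow> 'b::chilbert_space \<Rightarrow> 'h::chilbert_space"
  assumes "cdim (UNIV :: 'a set) > 1" and "cdim (UNIV :: 'b set) > 1"
    and t: "hilbert_tensor_product t"
  obtains w where "\<And>a b. w \<noteq> t a b"
proof -
  obtain a1 a2 :: 'a where a: "a1 \<noteq> 0" "a2 \<noteq> 0" "cinner a1 a2 = 0" "cinner a2 a1 = 0"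
    using orthogonal_pair_if_cdim_gt_one assms(1) by blast
  obtain b1 b2 :: 'b where b: "b1 \<noteq> 0" "b2 \<noteq> 0" "cinner b1 b2 = 0" "cinner b2 b1 = 0"
    using orthogonal_pair_if_cdim_gt_one assms(2) by blast
  have t_inner: "cinner (t a b) (t c d) = cinner a c * cinner b d" for a b c d
    using t by (simp add: hilbert_tensor_product_def)
  have "t a1 b1 + t a2 b2 \<noteq> t p q" for p q
  proof
    assume "t a1 b1 + t a2 b2 = t p q"
    then have coeff: "cinner p c * cinner q d = cinner a1 c * cinner b1 d + cinner a2 c * cinner b2 d"
      for c d
      by (metis cinner_add_left t_inner)
    from coeff[of a1 b1] coeff[of a2 b2] coeff[of a1 b2] a b show False
      by (auto simp: cinner_self)
  qed
  then show thesis
    using that by blast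
qed

section \<open>Square integrable functions\<close>

lemma L2_space_iff:
  "h \<in> L2_space M \<longleftrightarrow> h \<in> borel_measurable M \<and> integrable M (\<lambda>x. (cmod (h x))\<^sup>2)"
  by (simp add: L2_space_def)

lemma weighted_AM_GM:
  fixes a b e :: real
  assumes "e > 0"
  shows "a * b \<le> (e * a\<^sup>2 + b\<^sup>2 / e) / 2"
proof -
  have "0 \<le> (e * a - b)\<^sup>2 / e"
    using assms by simp
  also have "\<dots> = e * a\<^sup>2 + b\<^sup>2 / e - 2 * (a * b)"
    using assms by (simp add: power2_diff field_simps power2_eq_square)
  finally show ?thesis by simp
qed

lemma L2_space_mult_integrable:
  assumes "g \<in> L2_space M" and "h \<in> L2_space M"
  shows "integrable M (\<lambda>x. g x * cnj (h x))"
proof (rule Bochner_Integration.integrable_bound)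
  show "integrable M (\<lambda>x. (cmod (g x))\<^sup>2 + (cmod (h x))\<^sup>2)"
    using assms by (simp add: L2_space_iff)
  have "cnj \<in> borel_measurable borel"
    by (intro borel_measurable_continuous_onI continuous_intros)
  then show "(\<lambda>x. g x * cnj (h x)) \<in> borel_measurable M"
    using assms unfolding L2_space_iff
    by (intro borel_measurable_times measurable_compose[of h M borel cnj borel]) auto
  have "cmod (g x) * cmod (h x) \<le> (cmod (g x))\<^sup>2 + (cmod (h x))\<^sup>2" for x
  proof -
    have "cmod (g x) * cmod (h x) \<le> 2 * (cmod (g x) * cmod (h x))"
      by simp
    also have "\<dots> \<le> (cmod (g x))\<^sup>2 + (cmod (h x))\<^sup>2"
      using sum_squares_bound[of "cmod (g x)" "cmod (h x)"] by (simp add: mult.assoc)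
    finally show ?thesis .
  qed
  then show "AE x in M. norm (g x * cnj (h x)) \<le> norm ((cmod (g x))\<^sup>2 + (cmod (h x))\<^sup>2)"
    by (simp add: norm_mult)
qed

lemma L2_space_scale:
  assumes "g \<in> L2_space M"
  shows "(\<lambda>x. c * g x) \<in> L2_space M"
  using assms by (auto simp: L2_space_iff norm_mult power_mult_distrib)

lemma cmod_add_square_le: "(cmod (a + b))\<^sup>2 \<le> 2 * (cmod a)\<^sup>2 + 2 * (cmod b)\<^sup>2"
proof -
  have "(cmod (a + b))\<^sup>2 \<le> (cmod a + cmod b)\<^sup>2"
    by (intro power_mono norm_triangle_ineq) simp
  also have "\<dots> \<le> 2 * (cmod a)\<^sup>2 + 2 * (cmod b)\<^sup>2"
    using weighted_AM_GM[of 1 "cmod a" "cmod b"] by (simp add: power2_sum)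
  finally show ?thesis .
qed

lemma L2_space_add:
  assumes "g \<in> L2_space M" and "h \<in> L2_space M"
  shows "(\<lambda>x. g x + h x) \<in> L2_space M"
proof -
  have "integrable M (\<lambda>x. (cmod (g x + h x))\<^sup>2)"
  proof (rule Bochner_Integration.integrable_bound)
    show "integrable M (\<lambda>x. 2 * (cmod (g x))\<^sup>2 + 2 * (cmod (h x))\<^sup>2)"
      using assms by (simp add: L2_space_iff)
    show "(\<lambda>x. (cmod (g x + h x))\<^sup>2) \<in> borel_measurable M"
      using assms unfolding L2_space_iff
      by (intro borel_measurable_power borel_measurable_norm borel_measurable_add) auto
    show "AE x in M. norm ((cmod (g x + h x))\<^sup>2)
        \<le> norm (2 * (cmod (g x))\<^sup>2 + 2 * (cmod (h x))\<^sup>2)"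
      using cmod_add_square_le by (intro AE_I2) simp
  qed
  then show ?thesis
    using assms unfolding L2_space_iff by (blast intro: borel_measurable_add)
qed

lemma L2_inner_add_left:
  assumes "g \<in> L2_space M" "g' \<in> L2_space M" "h \<in> L2_space M"
  shows "L2_inner M (\<lambda>x. g x + g' x) h = L2_inner M g h + L2_inner M g' h"
  using assms by (simp add: L2_inner_def distrib_right L2_space_mult_integrable)

lemma L2_inner_scale_left:
  "L2_inner M (\<lambda>x. c * g x) h = c * L2_inner M g h"
  by (simp add: L2_inner_def mult.assoc)

lemma L2_inner_commute: "L2_inner M h g = cnj (L2_inner M g h)"
  unfolding L2_inner_def Bochner_Integration.integral_cnj[symmetric] by (simp add: mult.commute)

lemma L2_inner_self: "L2_inner M g g = complex_of_real (LINT x|M. (cmod (g x))\<^sup>2)"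
  by (simp add: L2_inner_def complex_norm_square[symmetric] flip: integral_complex_of_real of_real_power)

text \<open>Weighted form of the Cauchy--Schwarz inequality; a free weight lets one term be absorbed or
  the two terms be balanced.\<close>

lemma cmod_L2_inner_le:
  assumes "g \<in> L2_space M" "h \<in> L2_space M" "e > 0"
  shows "cmod (L2_inner M g h)
    \<le> (e * (LINT x|M. (cmod (g x))\<^sup>2) + (LINT x|M. (cmod (h x))\<^sup>2) / e) / 2"
proof -
  have int: "integrable M (\<lambda>x. (cmod (g x))\<^sup>2)" "integrable M (\<lambda>x. (cmod (h x))\<^sup>2)"
    using assms by (auto simp: L2_space_iff)
  have "cmod (L2_inner M g h) \<le> (LINT x|M. cmod (g x * cnj (h x)))"
    unfolding L2_inner_def by (rule integral_norm_bound)
  also have "\<dots> \<le> (LINT x|M. (e * (cmod (g x))\<^sup>2 + (cmod (h x))\<^sup>2 / e) / 2)"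
  proof (rule integral_mono)
    show "integrable M (\<lambda>x. cmod (g x * cnj (h x)))"
      using assms by (intro integrable_norm L2_space_mult_integrable)
    show "integrable M (\<lambda>x. (e * (cmod (g x))\<^sup>2 + (cmod (h x))\<^sup>2 / e) / 2)"
      using int by simp
    show "cmod (g x * cnj (h x)) \<le> (e * (cmod (g x))\<^sup>2 + (cmod (h x))\<^sup>2 / e) / 2" for x
      using weighted_AM_GM[OF assms(3)] by (simp add: norm_mult)
  qed
  also have "\<dots> = (e * (LINT x|M. (cmod (g x))\<^sup>2) + (LINT x|M. (cmod (h x))\<^sup>2) / e) / 2"
    using int by simp
  finally show ?thesis .
qed

section \<open>Representing functionals by a coercive form\<close>

text \<open>The symmetric case of the Lax--Milgram theorem. The representing vector minimises
  \<open>J u = Q u u - 2 L u\<close>: \<open>J\<close> is bounded below by coercivity, the parallelogram law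
  makes every minimising sequence Cauchy, and at the limit the first variation of \<open>J\<close>, which is
  \<open>2 (Q u v - L v)\<close> in the direction \<open>v\<close>, must vanish.\<close>

lemma coercive_form_represents_functional:
  fixes Q :: "'v::{real_normed_vector,complete_space} \<Rightarrow> 'v \<Rightarrow> real" and L :: "'v \<Rightarrow> real"
  assumes Q: "bounded_bilinear Q" and sym: "\<And>u v. Q u v = Q v u"
    and "A > 0" and coercive: "\<And>u. A * (norm u)\<^sup>2 \<le> Q u u"
    and L: "bounded_linear L"
  obtains u where "\<And>v. Q u v = L v"
proof -
  interpret Q: bounded_bilinear Q by (rule Q)
  interpret L: bounded_linear L by (rule L)
  define J where "J u = Q u u - 2 * L u" for u
  obtain C where C: "\<And>u. \<bar>L u\<bar> \<le> norm u * C"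
    using L.bounded by auto
  have "- (C\<^sup>2 / A) \<le> J u" for u
  proof -
    have "norm u * C \<le> (A * (norm u)\<^sup>2 + C\<^sup>2 / A) / 2"
      by (rule weighted_AM_GM) fact
    with C[of u] coercive[of u] show ?thesis
      unfolding J_def by argo
  qed
  then have bdd: "bdd_below (range J)"
    by (rule bdd_belowI2)
  define m where "m = (INF u. J u)"
  have m_le: "m \<le> J u" for u
    unfolding m_def using bdd by (rule cINF_lower) simp
  have "\<exists>u. J u < m + 1 / real (Suc n)" for n
  proof -
    have "(INF u. J u) < m + 1 / real (Suc n)"
      unfolding m_def by simp
    then show ?thesis
      using cINF_less_iff[OF _ bdd] by auto
  qed
  then obtain s where s: "\<And>n. J (s n) < m + 1 / real (Suc n)"
    by metis
  have parallelogram: "J u + J v = 2 * J ((1/2) *\<^sub>R (u + v)) + Q (u - v) (u - v) / 2" for u v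
    by (simp add: J_def Q.add_left Q.add_right Q.diff_left Q.diff_right Q.scaleR_left
        Q.scaleR_right L.add L.scaleR field_simps)
  have close: "(norm (s i - s j))\<^sup>2 \<le> 2 / A * (1 / real (Suc i) + 1 / real (Suc j))" for i j
  proof -
    have "A * (norm (s i - s j))\<^sup>2 / 2 \<le> 1 / real (Suc i) + 1 / real (Suc j)"
      using parallelogram[of "s i" "s j"] m_le[of "(1/2) *\<^sub>R (s i + s j)"]
        coercive[of "s i - s j"] s[of i] s[of j] by argo
    then show ?thesis
      using \<open>A > 0\<close> by (simp add: pos_le_divide_eq mult.commute)
  qed
  have "Cauchy s"
  proof (rule metric_CauchyI)
    fix e :: real assume "e > 0"
    then have "e\<^sup>2 * A / 4 > 0"
      using \<open>A > 0\<close> by simp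
    then obtain N where N: "1 / real (Suc N) < e\<^sup>2 * A / 4"
      using nat_approx_posE by blast
    show "\<exists>M. \<forall>i\<ge>M. \<forall>j\<ge>M. dist (s i) (s j) < e"
    proof (intro exI allI impI)
      fix i j assume "i \<ge> N" "j \<ge> N"
      then have "1 / real (Suc i) \<le> 1 / real (Suc N)" "1 / real (Suc j) \<le> 1 / real (Suc N)"
        by (auto intro!: divide_left_mono)
      with N have "1 / real (Suc i) + 1 / real (Suc j) < e\<^sup>2 * A / 2"
        by linarith
      then have "2 / A * (1 / real (Suc i) + 1 / real (Suc j)) < 2 / A * (e\<^sup>2 * A / 2)"
        using \<open>A > 0\<close> by (intro mult_strict_left_mono) auto
      also have "\<dots> = e\<^sup>2"
        using \<open>A > 0\<close> by simp
      finally have "(norm (s i - s j))\<^sup>2 < e\<^sup>2"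
        using close[of i j] by linarith
      then show "dist (s i) (s j) < e"
        using \<open>e > 0\<close> by (simp add: dist_norm power_less_imp_less_base)
    qed
  qed
  then obtain u where u: "s \<longlonglongrightarrow> u"
    using Cauchy_convergent_iff convergent_def by blast
  have "(\<lambda>n. J (s n)) \<longlonglongrightarrow> J u"
    unfolding J_def by (intro tendsto_intros Q.tendsto L.tendsto u)
  moreover have "(\<lambda>n. m + 1 / real (Suc n)) \<longlonglongrightarrow> m + 0"
    by (intro tendsto_intros LIMSEQ_Suc[OF lim_1_over_n])
  ultimately have "J u \<le> m"
    using s by (intro LIMSEQ_le[of "\<lambda>n. J (s n)" "J u" "\<lambda>n. m + 1 / real (Suc n)" m])
      (auto intro: less_imp_le)
  have "Q u v = L v" for v
  proof -
    have variation: "0 \<le> r\<^sup>2 * Q v v + 2 * r * (Q u v - L v)" for r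
    proof -
      have "J (u + r *\<^sub>R v) = J u + r\<^sup>2 * Q v v + 2 * r * (Q u v - L v)"
        by (simp add: J_def Q.add_left Q.add_right Q.scaleR_left Q.scaleR_right L.add L.scaleR
            sym[of v u] power2_eq_square algebra_simps)
      then show ?thesis
        using m_le[of "u + r *\<^sub>R v"] \<open>J u \<le> m\<close> by linarith
    qed
    define d where "d = Q u v - L v"
    have Qv: "Q v v \<ge> 0"
      using coercive[of v] \<open>A > 0\<close> by (smt (verit) mult_nonneg_nonneg zero_le_power2)
    \<comment> \<open>A nonzero slope \<open>d\<close> would make the quadratic negative at this step size.\<close>
    define r where "r = - d / (Q v v + 1)"
    have d: "d = - r * (Q v v + 1)"
      using Qv by (simp add: r_def)
    have "r\<^sup>2 * (Q v v + 2) \<le> 0"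
      using variation[of r] unfolding d_def[symmetric] unfolding d
      by (simp add: algebra_simps power2_eq_square)
    then have "r = 0"
      using Qv by (simp add: mult_le_0_iff)
    then have "d = 0"
      by (simp add: d)
    then show ?thesis
      by (simp add: d_def)
  qed
  then show thesis
    using that by blast
qed

section \<open>Frames\<close>

lemma continuous_frame_integrals:
  assumes "continuous_frame M F"
  obtains A B where "A > 0" and "B > 0" and "\<And>f. analysis_operator F f \<in> L2_space M"
    and "\<And>f. A * (norm f)\<^sup>2 \<le> (LINT x|M. (cmod (analysis_operator F f x))\<^sup>2)"
    and "\<And>f. (LINT x|M. (cmod (analysis_operator F f x))\<^sup>2) \<le> B * (norm f)\<^sup>2"
proof -
  obtain A B :: real where "A > 0"
    and lower: "\<And>f. ennreal (A * (norm f)\<^sup>2)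
      \<le> (\<integral>\<^sup>+ x. ennreal ((cmod (analysis_operator F f x))\<^sup>2) \<partial>M)"
    and upper: "\<And>f. (\<integral>\<^sup>+ x. ennreal ((cmod (analysis_operator F f x))\<^sup>2) \<partial>M)
      \<le> ennreal (B * (norm f)\<^sup>2)"
    using assms unfolding continuous_frame_def analysis_operator_def by blast
  have meas: "analysis_operator F f \<in> borel_measurable M" for f
    using assms unfolding continuous_frame_def weakly_measurable_def analysis_operator_def
    by blast
  have int: "integrable M (\<lambda>x. (cmod (analysis_operator F f x))\<^sup>2)" for f
  proof (rule integrableI_bounded)
    show "(\<lambda>x. (cmod (analysis_operator F f x))\<^sup>2) \<in> borel_measurable M"
      using meas by simp
    show "(\<integral>\<^sup>+ x. ennreal (norm ((cmod (analysis_operator F f x))\<^sup>2)) \<partial>M) < \<infinity>"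
      using upper[of f] by (simp add: order_le_less_trans)
  qed
  have nn: "(\<integral>\<^sup>+ x. ennreal ((cmod (analysis_operator F f x))\<^sup>2) \<partial>M)
      = ennreal (LINT x|M. (cmod (analysis_operator F f x))\<^sup>2)" for f
    using int by (intro nn_integral_eq_integral) auto
  have pos: "0 \<le> (LINT x|M. (cmod (analysis_operator F f x))\<^sup>2)" for f
    by (rule integral_nonneg_AE) simp
  show thesis
  \<comment> \<open>On the trivial space any real number is an upper frame bound, even a negative one.\<close>
  proof (rule that[of A "max B 1"])
    show "A * (norm f)\<^sup>2 \<le> (LINT x|M. (cmod (analysis_operator F f x))\<^sup>2)" for f
      using lower[of f] pos[of f] by (simp add: nn ennreal_le_iff)
    have "ennreal (B * (norm f)\<^sup>2) \<le> ennreal (max B 1 * (norm f)\<^sup>2)" for f :: 'b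
      by (intro ennreal_leI mult_right_mono) auto
    then have "ennreal (LINT x|M. (cmod (analysis_operator F f x))\<^sup>2)
        \<le> ennreal (max B 1 * (norm f)\<^sup>2)" for f
      using upper[of f] order_trans unfolding nn by blast
    then show "(LINT x|M. (cmod (analysis_operator F f x))\<^sup>2) \<le> max B 1 * (norm f)\<^sup>2" for f
      by (simp add: ennreal_le_iff)
  qed (use \<open>A > 0\<close> meas int in \<open>auto simp: L2_space_iff\<close>)
qed

lemma continuous_frameI:
  assumes "A > 0" and "\<And>f. analysis_operator F f \<in> L2_space M"
    and "\<And>f. A * (norm f)\<^sup>2 \<le> (LINT x|M. (cmod (analysis_operator F f x))\<^sup>2)"
    and "\<And>f. (LINT x|M. (cmod (analysis_operator F f x))\<^sup>2) \<le> B * (norm f)\<^sup>2"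
  shows "continuous_frame M F"
proof -
  have nn: "(\<integral>\<^sup>+ x. ennreal ((cmod (analysis_operator F f x))\<^sup>2) \<partial>M)
      = ennreal (LINT x|M. (cmod (analysis_operator F f x))\<^sup>2)" for f
    using assms(2)[of f] by (intro nn_integral_eq_integral) (auto simp: L2_space_iff)
  have "weakly_measurable M F"
    using assms(2) by (simp add: weakly_measurable_def analysis_operator_def L2_space_iff)
  moreover have "ennreal (A * (norm f)\<^sup>2)
        \<le> (\<integral>\<^sup>+ x. ennreal ((cmod (analysis_operator F f x))\<^sup>2) \<partial>M)
      \<and> (\<integral>\<^sup>+ x. ennreal ((cmod (analysis_operator F f x))\<^sup>2) \<partial>M)
        \<le> ennreal (B * (norm f)\<^sup>2)" for f
    unfolding nn using assms(3,4)[of f] by (simp add: ennreal_leI)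
  ultimately show ?thesis
    using \<open>A > 0\<close> unfolding continuous_frame_def analysis_operator_def by blast
qed

text \<open>An upper bound for \<open>G\<close> is enough: the duality identity at \<open>g = f\<close> writes \<open>\<parallel>f\<parallel>\<^sup>2\<close> as the
  inner product of the two analysis functions, so by Cauchy--Schwarz the one of \<open>G\<close> cannot be
  small.\<close>

lemma continuous_dual_frameI:
  assumes F: "continuous_frame M F"
    and G: "\<And>f. analysis_operator G f \<in> L2_space M"
    and upper: "\<And>f. (LINT x|M. (cmod (analysis_operator G f x))\<^sup>2) \<le> C * (norm f)\<^sup>2"
    and dual: "\<And>f g. L2_inner M (analysis_operator F f) (analysis_operator G g) = cinner f g"
  shows "continuous_dual_frame M F G"
proof -
  obtain B where "B > 0" and F_L2: "\<And>f. analysis_operator F f \<in> L2_space M"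
    and B: "\<And>f. (LINT x|M. (cmod (analysis_operator F f x))\<^sup>2) \<le> B * (norm f)\<^sup>2"
    using continuous_frame_integrals[OF F] by metis
  have "continuous_frame M G"
  proof (rule continuous_frameI[where A = "1 / B" and B = C])
    fix f
    let ?F = "LINT x|M. (cmod (analysis_operator F f x))\<^sup>2"
    let ?G = "LINT x|M. (cmod (analysis_operator G f x))\<^sup>2"
    have "(norm f)\<^sup>2 = cmod (L2_inner M (analysis_operator F f) (analysis_operator G f))"
      by (simp only: dual cinner_self norm_of_real) simp
    \<comment> \<open>With weight \<open>1 / B\<close> the term of \<open>F\<close> is at most half of the left-hand side.\<close>
    also have "\<dots> \<le> (1 / B * ?F + ?G / (1 / B)) / 2"
      using \<open>B > 0\<close> by (intro cmod_L2_inner_le F_L2 G) simp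
    also have "\<dots> \<le> ((norm f)\<^sup>2 + B * ?G) / 2"
      using B[of f] \<open>B > 0\<close> by (simp add: field_simps)
    finally show "1 / B * (norm f)\<^sup>2 \<le> ?G"
      using \<open>B > 0\<close> by (simp add: field_simps)
  qed (use \<open>B > 0\<close> G upper in auto)
  moreover have "cinner f g = (LINT x|M. cinner f (F x) * cinner (G x) g)" for f g
    using dual[of f g]
    by (simp add: L2_inner_def analysis_operator_def cinner_commute[of "G _" g])
  ultimately show ?thesis
    using F unfolding continuous_dual_frame_def by blast
qed

text \<open>The vector \<open>u\<close> is the preimage of \<open>f\<close> under the frame operator. Applied to the real part of the frame form
  \<open>\<langle>T\<^sup>* u, T\<^sup>* v\<rangle>\<close> and of \<open>\<langle>f, v\<rangle>\<close>, the representation lemma gives the real part of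
  the identity; replacing \<open>v\<close> by \<open>\<i> v\<close> gives the imaginary part.\<close>

lemma frame_operator_surjective:
  fixes F :: "'x \<Rightarrow> 'h::chilbert_space"
  assumes "continuous_frame M F"
  shows "\<exists>u. \<forall>v. L2_inner M (analysis_operator F u) (analysis_operator F v) = cinner f v"
proof -
  obtain A B where "A > 0" and L2: "\<And>f. analysis_operator F f \<in> L2_space M"
    and A: "\<And>f. A * (norm f)\<^sup>2 \<le> (LINT x|M. (cmod (analysis_operator F f x))\<^sup>2)"
    and B: "\<And>f. (LINT x|M. (cmod (analysis_operator F f x))\<^sup>2) \<le> B * (norm f)\<^sup>2"
    using continuous_frame_integrals[OF assms] by metis
  define Q where "Q u v = L2_inner M (analysis_operator F u) (analysis_operator F v)" for u v
  have Q_commute: "Q u v = cnj (Q v u)" for u v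
    unfolding Q_def by (rule L2_inner_commute)
  have analysis_add: "analysis_operator F (u + v)
      = (\<lambda>x. analysis_operator F u x + analysis_operator F v x)" for u v
    by (simp add: analysis_operator_def cinner_add_left)
  have analysis_scale: "analysis_operator F (c *\<^sub>C u) = (\<lambda>x. c * analysis_operator F u x)" for c u
    by (simp add: analysis_operator_def cinner_scaleC_left)
  have Q_add: "Q (u + u') v = Q u v + Q u' v" for u u' v
    unfolding Q_def analysis_add by (intro L2_inner_add_left L2)
  have Q_scale: "Q (c *\<^sub>C u) v = c * Q u v" for c u v
    unfolding Q_def analysis_scale by (rule L2_inner_scale_left)
  have Q_bound: "cmod (Q u v) \<le> norm u * norm v * B" for u v
  proof (cases "u = 0 \<or> v = 0")
    case True
    moreover have "Q 0 w = 0" "Q w 0 = 0" for w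
      using Q_add[of 0 0 w] Q_commute[of w 0] by simp_all
    ultimately show ?thesis
      by auto
  next
    case False
    \<comment> \<open>This weight balances the two terms of the weighted Cauchy--Schwarz bound.\<close>
    let ?e = "norm v / norm u"
    have e: "?e > 0"
      using False by simp
    have "cmod (Q u v) \<le> (?e * (LINT x|M. (cmod (analysis_operator F u x))\<^sup>2)
        + (LINT x|M. (cmod (analysis_operator F v x))\<^sup>2) / ?e) / 2"
      unfolding Q_def using e by (intro cmod_L2_inner_le L2)
    also have "\<dots> \<le> (?e * (B * (norm u)\<^sup>2) + (B * (norm v)\<^sup>2) / ?e) / 2"
      using e by (intro divide_right_mono add_mono mult_left_mono B) auto
    also have "\<dots> = norm u * norm v * B"
      using False by (simp add: field_simps power2_eq_square)
    finally show ?thesis .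
  qed
  have "bounded_bilinear (\<lambda>u v. Re (Q u v))"
  proof
    show "Re (Q (u + u') v) = Re (Q u v) + Re (Q u' v)" for u u' v
      by (simp add: Q_add)
    show "Re (Q u (v + v')) = Re (Q u v) + Re (Q u v')" for u v v'
      using Q_add[of v v' u] by (simp add: Q_commute[of u])
    show "Re (Q (r *\<^sub>R u) v) = r *\<^sub>R Re (Q u v)" for r u v
      by (simp add: scaleR_scaleC Q_scale)
    show "Re (Q u (r *\<^sub>R v)) = r *\<^sub>R Re (Q u v)" for r u v
      by (simp add: scaleR_scaleC Q_scale Q_commute[of u])
    show "\<exists>K. \<forall>u v. norm (Re (Q u v)) \<le> norm u * norm v * K"
      using Q_bound abs_Re_le_cmod order_trans unfolding real_norm_def by blast
  qed
  moreover have "Re (Q u v) = Re (Q v u)" for u v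
    by (simp add: Q_commute[of u])
  moreover have "A * (norm u)\<^sup>2 \<le> Re (Q u u)" for u
    using A[of u] by (simp add: Q_def L2_inner_self)
  moreover have "bounded_linear (\<lambda>v. Re (cinner f v))"
  proof
    show "Re (cinner f (v + v')) = Re (cinner f v) + Re (cinner f v')" for v v'
      by (simp add: cinner_add_right)
    show "Re (cinner f (r *\<^sub>R v)) = r *\<^sub>R Re (cinner f v)" for r v
      by (simp add: scaleR_scaleC cinner_scaleC_right)
    show "\<exists>K. \<forall>v. norm (Re (cinner f v)) \<le> norm v * K"
    proof (intro exI allI)
      show "norm (Re (cinner f v)) \<le> norm v * norm f" for v
        using abs_Re_le_cmod[of "cinner f v"] cinner_Cauchy_Schwarz[of f v]
        by (simp add: mult.commute)
    qed
  qed
  ultimately obtain u where u: "\<And>v. Re (Q u v) = Re (cinner f v)"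
    using coercive_form_represents_functional[of "\<lambda>u v. Re (Q u v)" A "\<lambda>v. Re (cinner f v)"]
      \<open>A > 0\<close> by blast
  have "Q u v = cinner f v" for v
  proof (rule complex_eqI)
    show "Re (Q u v) = Re (cinner f v)"
      by (rule u)
    have "Q u (\<i> *\<^sub>C v) = - \<i> * Q u v"
      by (simp add: Q_commute[of u] Q_scale)
    then show "Im (Q u v) = Im (cinner f v)"
      using u[of "\<i> *\<^sub>C v"] by (simp add: cinner_scaleC_right)
  qed
  then show ?thesis
    unfolding Q_def by blast
qed

text \<open>The canonical dual \<open>R F\<close>, where \<open>R\<close> is the inverse frame operator. As \<open>R\<close> is
  self-adjoint, the analysis function of \<open>R F\<close> at \<open>f\<close> is that of \<open>F\<close> at \<open>R f\<close>, and the defining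
  identity of \<open>R\<close> becomes duality.\<close>

lemma canonical_dual_frame:
  fixes F :: "'x \<Rightarrow> 'h::chilbert_space"
  assumes F: "continuous_frame M F"
  obtains G where "continuous_dual_frame M F G"
proof -
  obtain A B where "A > 0" "B > 0" and L2: "\<And>f. analysis_operator F f \<in> L2_space M"
    and A: "\<And>f. A * (norm f)\<^sup>2 \<le> (LINT x|M. (cmod (analysis_operator F f x))\<^sup>2)"
    and B: "\<And>f. (LINT x|M. (cmod (analysis_operator F f x))\<^sup>2) \<le> B * (norm f)\<^sup>2"
    using continuous_frame_integrals[OF F] by metis
  obtain R where
    R: "\<And>f v. L2_inner M (analysis_operator F (R f)) (analysis_operator F v) = cinner f v"
    using frame_operator_surjective[OF F] by metis
  have self_adjoint: "cinner f (R g) = cinner (R f) g" for f g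
    by (metis R L2_inner_commute cinner_commute)
  have analysis: "analysis_operator (\<lambda>x. R (F x)) f = analysis_operator F (R f)" for f
    by (simp add: analysis_operator_def self_adjoint)
  have R_bound: "norm (R f) \<le> norm f / A" for f
  proof (cases "R f = 0")
    case False
    have "complex_of_real (LINT x|M. (cmod (analysis_operator F (R f) x))\<^sup>2) = cinner f (R f)"
      by (metis L2_inner_self R)
    then have "A * (norm (R f))\<^sup>2 \<le> Re (cinner f (R f))"
      using A[of "R f"] by (metis Re_complex_of_real)
    also have "\<dots> \<le> norm f * norm (R f)"
      by (rule Re_cinner_le)
    finally show ?thesis
      using False \<open>A > 0\<close> by (simp add: power2_eq_square field_simps)
  qed (use \<open>A > 0\<close> in simp)
  have "continuous_dual_frame M F (\<lambda>x. R (F x))"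
  proof (rule continuous_dual_frameI[where C = "B / A\<^sup>2", OF F])
    fix f g
    show "analysis_operator (\<lambda>x. R (F x)) f \<in> L2_space M"
      unfolding analysis by (rule L2)
    have "(LINT x|M. (cmod (analysis_operator F (R f) x))\<^sup>2) \<le> B * (norm (R f))\<^sup>2"
      by (rule B)
    also have "\<dots> \<le> B * (norm f / A)\<^sup>2"
      using \<open>B > 0\<close> by (intro mult_left_mono power_mono R_bound) auto
    finally show "(LINT x|M. (cmod (analysis_operator (\<lambda>x. R (F x)) f x))\<^sup>2)
        \<le> B / A\<^sup>2 * (norm f)\<^sup>2"
      by (simp add: analysis power_divide)
    show "L2_inner M (analysis_operator F f) (analysis_operator (\<lambda>x. R (F x)) g) = cinner f g"
      unfolding analysis by (metis R L2_inner_commute cinner_commute)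
  qed
  then show thesis
    using that by blast
qed

section \<open>Perturbing a dual frame\<close>

text \<open>A rank-one perturbation by a function orthogonal to the analysis functions of \<open>F\<close> adds
  \<open>\<langle>T\<^sup>* f, h\<rangle> \<langle>\<phi>, g\<rangle> = 0\<close> to the duality integral.\<close>

lemma perturbed_dual_frame:
  fixes F :: "'x \<Rightarrow> 'h::chilbert_space"
  assumes dual: "continuous_dual_frame M F G"
    and h: "h \<in> L2_orthogonal_complement M (range (analysis_operator F))"
  shows "continuous_dual_frame M F (\<lambda>x. G x + cnj (h x) *\<^sub>C \<phi>)"
proof -
  let ?G = "\<lambda>x. G x + cnj (h x) *\<^sub>C \<phi>"
  have F: "continuous_frame M F" and G: "continuous_frame M G"
    and FG: "\<And>f g. cinner f g = (LINT x|M. cinner f (F x) * cinner (G x) g)"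
    using dual unfolding continuous_dual_frame_def by blast+
  have h_L2: "h \<in> L2_space M"
    and h_orth: "\<And>f. L2_inner M (analysis_operator F f) h = 0"
    using h by (auto simp: L2_orthogonal_complement_def)
  have F_L2: "analysis_operator F f \<in> L2_space M" for f
    using continuous_frame_integrals[OF F] by metis
  obtain B where G_L2: "\<And>f. analysis_operator G f \<in> L2_space M"
    and B: "\<And>f. (LINT x|M. (cmod (analysis_operator G f x))\<^sup>2) \<le> B * (norm f)\<^sup>2"
    using continuous_frame_integrals[OF G] by metis
  have analysis: "analysis_operator ?G f = (\<lambda>x. analysis_operator G f x + cinner f \<phi> * h x)" for f
    by (simp add: analysis_operator_def cinner_add_right cinner_scaleC_right mult.commute)
  define H where "H = (LINT x|M. (cmod (h x))\<^sup>2)"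
  have "H \<ge> 0"
    unfolding H_def by (rule integral_nonneg_AE) simp
  have L2: "analysis_operator ?G f \<in> L2_space M" for f
    unfolding analysis by (intro L2_space_add L2_space_scale G_L2 h_L2)
  show ?thesis
  proof (rule continuous_dual_frameI[where C = "2 * B + 2 * (norm \<phi>)\<^sup>2 * H", OF F L2])
    fix f g
    have int: "integrable M (\<lambda>x. (cmod (analysis_operator G f x))\<^sup>2)"
      "integrable M (\<lambda>x. (cmod (h x))\<^sup>2)"
      "integrable M (\<lambda>x. (cmod (analysis_operator ?G f x))\<^sup>2)"
      using G_L2 h_L2 L2 by (auto simp: L2_space_iff)
    have "(LINT x|M. (cmod (analysis_operator ?G f x))\<^sup>2) \<le>
        (LINT x|M. 2 * (cmod (analysis_operator G f x))\<^sup>2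
          + 2 * ((cmod (cinner f \<phi>))\<^sup>2 * (cmod (h x))\<^sup>2))"
    proof (rule integral_mono)
      show "integrable M (\<lambda>x. 2 * (cmod (analysis_operator G f x))\<^sup>2
          + 2 * ((cmod (cinner f \<phi>))\<^sup>2 * (cmod (h x))\<^sup>2))"
        using int by simp
      show "(cmod (analysis_operator ?G f x))\<^sup>2 \<le> 2 * (cmod (analysis_operator G f x))\<^sup>2
          + 2 * ((cmod (cinner f \<phi>))\<^sup>2 * (cmod (h x))\<^sup>2)" for x
        using cmod_add_square_le[of "analysis_operator G f x" "cinner f \<phi> * h x"]
        by (simp add: analysis norm_mult power_mult_distrib)
    qed (rule int)
    also have "\<dots> = 2 * (LINT x|M. (cmod (analysis_operator G f x))\<^sup>2)
        + 2 * ((cmod (cinner f \<phi>))\<^sup>2 * H)"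
      using int by (simp add: H_def)
    also have "\<dots> \<le> 2 * (B * (norm f)\<^sup>2) + 2 * ((norm f * norm \<phi>)\<^sup>2 * H)"
      using B[of f] \<open>H \<ge> 0\<close>
      by (intro add_mono mult_left_mono mult_right_mono power_mono cinner_Cauchy_Schwarz) auto
    also have "\<dots> = (2 * B + 2 * (norm \<phi>)\<^sup>2 * H) * (norm f)\<^sup>2"
      by (simp add: power_mult_distrib algebra_simps)
    finally show "(LINT x|M. (cmod (analysis_operator ?G f x))\<^sup>2)
        \<le> (2 * B + 2 * (norm \<phi>)\<^sup>2 * H) * (norm f)\<^sup>2" .
    have "L2_inner M (analysis_operator ?G g) (analysis_operator F f)
        = L2_inner M (analysis_operator G g) (analysis_operator F f)
          + cinner g \<phi> * L2_inner M h (analysis_operator F f)"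
      unfolding analysis
      by (simp add: L2_inner_add_left L2_inner_scale_left G_L2 F_L2 h_L2 L2_space_scale)
    also have "L2_inner M h (analysis_operator F f) = 0"
      by (subst L2_inner_commute) (simp add: h_orth)
    also have "L2_inner M (analysis_operator G g) (analysis_operator F f) = cinner g f"
    proof -
      have "cinner f g = L2_inner M (analysis_operator F f) (analysis_operator G g)"
        unfolding FG[of f g] L2_inner_def analysis_operator_def
        by (simp add: cinner_commute[of "G _" g])
      then show ?thesis
        by (metis L2_inner_commute cinner_commute)
    qed
    finally have "L2_inner M (analysis_operator ?G g) (analysis_operator F f) = cinner g f"
      by simp
    then show "L2_inner M (analysis_operator F f) (analysis_operator ?G g) = cinner f g"
      by (subst L2_inner_commute, subst cinner_commute) simp
  qed
qed

text \<open>An element of an \<open>L\<^sup>2\<close>-independent set cannot vanish everywhere: the coefficient function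
  that is \<open>1\<close> at this element and \<open>0\<close> elsewhere would violate independence.\<close>

lemma L2_dim_pos_nonzero_element:
  assumes "L2_dim M V > 0"
  obtains h x where "h \<in> V" and "x \<in> space M" and "h x \<noteq> 0"
proof -
  from assms obtain B where B: "B \<subseteq> V" "finite B" "L2_independent M B"
    and "0 < enat (card B)"
    unfolding L2_dim_def less_SUP_iff by blast
  then have "card B > 0"
    by (metis enat_0_iff(1) gr0I less_irrefl)
  then obtain b where b: "b \<in> B"
    by (metis card_gt_0_iff equals0I)
  have "\<exists>x \<in> space M. b x \<noteq> 0"
  proof (rule ccontr)
    assume "\<not> (\<exists>x \<in> space M. b x \<noteq> 0)"
    then have "AE x in M. (\<Sum>b'\<in>B. (if b' = b then 1 else 0) * b' x) = 0"
      by (intro AE_I2 sum.neutral) auto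
    moreover have "(AE x in M. (\<Sum>b'\<in>B. (if b' = b then 1 else 0) * b' x) = 0) \<longrightarrow>
        (\<forall>b'\<in>B. (if b' = b then 1 else 0 :: complex) = 0)"
      using B(3) unfolding L2_independent_def by (rule spec)
    ultimately have "\<forall>b'\<in>B. (if b' = b then 1 else 0 :: complex) = 0"
      by (rule rev_mp)
    then show False
      using b by auto
  qed
  then show thesis
    using that B(1) b by blast
qed

text \<open>Where the orthogonal function \<open>h\<close> does not vanish, the vector \<open>\<phi>\<close> of the perturbation can be
  solved for.\<close>

lemma redundant_frame_dual_with_prescribed_value:
  fixes F :: "'x \<Rightarrow> 'h::chilbert_space"
  assumes "redundant_frame M F"
  obtains x where "x \<in> space M" and "\<And>w. \<exists>G. continuous_dual_frame M F G \<and> G x = w"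
proof -
  obtain G0 where G0: "continuous_dual_frame M F G0"
    using assms canonical_dual_frame unfolding redundant_frame_def by blast
  obtain h x where h: "h \<in> L2_orthogonal_complement M (range (analysis_operator F))"
    and x: "x \<in> space M" "h x \<noteq> 0"
    using assms L2_dim_pos_nonzero_element unfolding redundant_frame_def by metis
  have "\<exists>G. continuous_dual_frame M F G \<and> G x = w" for w
  proof (intro exI conjI)
    let ?G = "\<lambda>y. G0 y + cnj (h y) *\<^sub>C (inverse (cnj (h x)) *\<^sub>C (w - G0 x))"
    show "continuous_dual_frame M F ?G"
      using G0 h by (rule perturbed_dual_frame)
    show "?G x = w"
      using x(2) by (simp add: scaleC_scaleC scaleC_one)
  qed
  with x(1) show thesis
    by (rule that)
qed

section \<open>Tensor product frames\<close>

theorem lemma3p8: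
  fixes t :: "'a::chilbert_space \<Rightarrow> 'b::chilbert_space \<Rightarrow> 'h::chilbert_space"
    and M1 :: "'x measure" and M2 :: "'y measure"
    and F1 :: "'x \<Rightarrow> 'a" and F2 :: "'y \<Rightarrow> 'b"
  assumes "separable_space (euclidean :: 'a topology)"
    and "separable_space (euclidean :: 'b topology)"
    and "cdim (UNIV :: 'a set) > 1"
    and "cdim (UNIV :: 'b set) > 1"
    and "hilbert_tensor_product t"
    and "sigma_finite_measure M1"
    and "sigma_finite_measure M2"
    and "redundant_frame (M1 \<Otimes>\<^sub>M M2) (tensor_map t F1 F2)"
  shows "\<exists>G. continuous_dual_frame (M1 \<Otimes>\<^sub>M M2) (tensor_map t F1 F2) G \<and>
     \<not> (\<exists>(G1 :: 'x \<Rightarrow> 'a) (G2 :: 'y \<Rightarrow> 'b).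
          \<forall>x \<in> space (M1 \<Otimes>\<^sub>M M2). G x = tensor_map t G1 G2 x)"
proof -
  obtain w where w: "\<And>a b. w \<noteq> t a b"
    using exists_non_simple_tensor assms(3-5) by blast
  obtain x where x: "x \<in> space (M1 \<Otimes>\<^sub>M M2)"
    and "\<And>w. \<exists>G. continuous_dual_frame (M1 \<Otimes>\<^sub>M M2) (tensor_map t F1 F2) G \<and> G x = w"
    using redundant_frame_dual_with_prescribed_value[OF assms(8)] by blast
  then obtain G where G: "continuous_dual_frame (M1 \<Otimes>\<^sub>M M2) (tensor_map t F1 F2) G" "G x = w"
    by blast
  have "G x \<noteq> tensor_map t G1 G2 x" for G1 G2
    using w by (simp add: G(2) tensor_map_def split_beta)
  with G(1) x show ?thesis
    by blast
qed

end
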